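(* Let $G_0,G_1\in\mathbb{Z}$ with $\gcd(G_0,G_1)=1$, and let $(G_n)_{n\ge0}$ satisfy $G_n=G_{n-1}+G_{n-2}$ for $n\ge2$. If $k$ is a positive integer with $k\equiv 1,5,7,11\pmod{12}$ and $\pi_{G_0,G_1}(m)$ is even for all integers $m>2$, then $\mathcal{G}_{G_0,G_1}(k)=1$. In particular, for such $k$, $\mathcal{F}(k)=1$, $\mathcal{L}(k)=1$, and $\mathcal{G}_{G_0,G_1}(k)=1$ whenever $G_1^2-G_0G_1-G_0^2=\pm1$.
   Context: For a positive integer $k$, $\mathcal{G}_{G_0,G_1}(k)$ is the greatest common divisor of all integers $\sum_{i=0}^{k-1}G_{n+i}$, $n\ge1$; $\mathcal{F}(k)$ and $\mathcal{L}(k)$ denote this quantity for the Fibonacci sequence ($G_0=0,G_1=1$) and the Lucas sequence ($G_0=2,G_1=1$). For $m\ge2$, $\pi_{G_0,G_1}(m)$ is the smallest positive integer $r$ with $G_r\equiv G_0$ and $G_{r+1}\equiv G_1 \pmod m$. *)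

theory Defs
  imports "HOL-Number_Theory.Number_Theory"
begin

fun gen_fib :: "int \<Rightarrow> int \<Rightarrow> nat \<Rightarrow> int" where
  "gen_fib G0 G1 0 = G0"
| "gen_fib G0 G1 (Suc 0) = G1"
| "gen_fib G0 G1 (Suc (Suc n)) = gen_fib G0 G1 (Suc n) + gen_fib G0 G1 n"

lemma gen_fib_0_1_eq_fib: "gen_fib 0 1 n = int (fib n)"
  by (induction n rule: fib.induct) simp_all

definition sum_gcd :: "int \<Rightarrow> int \<Rightarrow> nat \<Rightarrow> int" where
  "sum_gcd G0 G1 k = Gcd {(\<Sum>i<k. gen_fib G0 G1 (n + i)) | n. n \<ge> 1}"

definition fib_sum_gcd :: "nat \<Rightarrow> int" where
  "fib_sum_gcd k = sum_gcd 0 1 k"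

definition lucas_sum_gcd :: "nat \<Rightarrow> int" where
  "lucas_sum_gcd k = sum_gcd 2 1 k"

text \<open>A suitable \<open>r\<close> exists for every \<open>m \<ge> 1\<close>: the step \<open>(a, b) \<mapsto> (b, a + b)\<close> is a
  bijection on the finitely many pairs of residues modulo \<open>m\<close>.\<close>

definition period :: "int \<Rightarrow> int \<Rightarrow> int \<Rightarrow> nat" where
  "period G0 G1 m = (LEAST r. r > 0 \<and> [gen_fib G0 G1 r = G0] (mod m)
                                    \<and> [gen_fib G0 G1 (r + 1) = G1] (mod m))"

end

theory Submission imports Defs
begin

text \<open>The window sum telescopes to \<open>G (n + k + 1) - G (n + 1)\<close>, so a modulus divides all of
  them iff \<open>k\<close> is a multiple of the period of the sequence. Modulo \<open>2\<close> this forces \<open>3 dvd k\<close>;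
  for a modulus \<open>m > 2\<close> it forces \<open>k\<close> even when the period is even. In the special cases, the
  invariant \<open>G\<^sub>1\<^sup>2 - G\<^sub>0 G\<^sub>1 - G\<^sub>0\<^sup>2\<close>, which changes sign at each step, shows that a modulus with an
  odd period divides twice that invariant; for the Lucas sequence this leaves only \<open>m = 5\<close>, where
  the period is \<open>4\<close>.\<close>

text \<open>Neither minimality nor positivity is demanded, so the remainder \<open>k mod p\<close>
  of a return index can itself qualify, even when it is 0.\<close>

definition is_period :: "int \<Rightarrow> int \<Rightarrow> int \<Rightarrow> nat \<Rightarrow> bool" where
  "is_period a b m r \<longleftrightarrow>
     [gen_fib a b r = a] (mod m) \<and> [gen_fib a b (Suc r) = b] (mod m)"

lemma sum_gen_fib:
  "(\<Sum>i<k. gen_fib a b (n + i)) = gen_fib a b (Suc (n + k)) - gen_fib a b (Suc n)"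
  by (induction k) simp_all

text \<open>Windows start at \<open>n = 1\<close>, so they compare values from index 2 on. The
  congruences at indices 2 and 3 are carried back to 1 and 0 by running the recurrence in
  reverse.\<close>

lemma dvd_sum_gcd_imp_is_period:
  assumes "m dvd sum_gcd a b k"
  shows "is_period a b m k"
proof -
  have *: "[gen_fib a b (Suc (n + k)) = gen_fib a b (Suc n)] (mod m)" if "n \<ge> 1" for n
  proof -
    have "sum_gcd a b k dvd (\<Sum>i<k. gen_fib a b (n + i))"
      unfolding sum_gcd_def by (rule Gcd_dvd) (use that in blast)
    with assms show ?thesis
      unfolding sum_gen_fib cong_iff_dvd_diff by (rule dvd_trans)
  qed
  have two: "[gen_fib a b (Suc (Suc k)) = gen_fib a b 2] (mod m)"
    using *[of 1] by (simp add: numeral_2_eq_2)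
  have three: "[gen_fib a b (Suc (Suc (Suc k))) = gen_fib a b 3] (mod m)"
    using *[of 2] by (simp add: numeral_2_eq_2 numeral_3_eq_3)
  have one: "[gen_fib a b (Suc k) = b] (mod m)"
    using cong_diff[OF three two] by (simp add: numeral_2_eq_2 numeral_3_eq_3)
  have "[gen_fib a b k = a] (mod m)"
    using cong_diff[OF two one] by (simp add: numeral_2_eq_2)
  with one show ?thesis by (simp add: is_period_def)
qed

lemma is_period_shift:
  assumes "is_period a b m p"
  shows "[gen_fib a b (n + p) = gen_fib a b n] (mod m)"
  using assms
proof (induction a b n rule: gen_fib.induct)
  case (3 a b n)
  then show ?case by (simp add: cong_add)
qed (simp_all add: is_period_def)

lemma is_period_shift_mult:
  assumes "is_period a b m p"
  shows "[gen_fib a b (n + p * q) = gen_fib a b n] (mod m)"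
proof (induction q)
  case (Suc q)
  have "[gen_fib a b (n + p * q + p) = gen_fib a b (n + p * q)] (mod m)"
    using is_period_shift[OF assms] .
  from cong_trans[OF this Suc] show ?case by (simp add: add_ac)
qed simp

lemma period_dvd:
  assumes "is_period a b m k" "k > 0"
  shows "period a b m dvd k"
proof -
  let ?P = "\<lambda>r. r > 0 \<and> is_period a b m r"
  define p where "p = period a b m"
  have p_eq: "p = (LEAST r. ?P r)"
    by (simp add: p_def period_def is_period_def)
  \<comment> \<open>The given \<open>k\<close> witnesses that the \<open>LEAST\<close> is
    attained.\<close>
  have p: "?P p"
    unfolding p_eq using assms by (intro LeastI[of ?P k]) auto
  have red: "[gen_fib a b (n + k mod p) = gen_fib a b (n + k)] (mod m)" for n
    using cong_sym[OF is_period_shift_mult[of a b m p "n + k mod p" "k div p"]] p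
    by (simp add: add.assoc)
  have "is_period a b m (k mod p)"
    unfolding is_period_def
    using assms(1) cong_trans[OF red[of 0]] cong_trans[OF red[of 1]]
    by (simp add: is_period_def)
  \<comment> \<open>A remainder is smaller than the least positive return \<open>p\<close>, so it
    can only be 0.\<close>
  moreover have "\<not> ?P (k mod p)"
    using p not_less_Least[of "k mod p" ?P] by (simp add: p_eq[symmetric])
  ultimately show ?thesis
    by (auto simp: p_def)
qed

text \<open>Modulo 2 every such sequence repeats after 3 steps, and a return after 1 or 2 steps
  would make both initial values even.\<close>

lemma is_period_2_imp_3_dvd:
  assumes "coprime a b" "is_period a b 2 k"
  shows "3 dvd k"
proof (rule ccontr)
  assume "\<not> 3 dvd k"
  then have k: "k mod 3 = 1 \<or> k mod 3 = 2" by presburger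
  have "is_period a b 2 3"
    by (simp add: is_period_def numeral_3_eq_3 cong_iff_dvd_diff)
  from is_period_shift_mult[OF this]
  have red: "[gen_fib a b (n + k mod 3) = gen_fib a b (n + k)] (mod 2)" for n
    using cong_sym by (metis add.assoc mod_mult_div_eq)
  have "[gen_fib a b (k mod 3) = a] (mod 2)" "[gen_fib a b (Suc (k mod 3)) = b] (mod 2)"
    using assms(2) cong_trans[OF red[of 0]] cong_trans[OF red[of 1]]
    by (simp_all add: is_period_def)
  with k have "even a \<and> even b"
    by (auto simp: numeral_2_eq_2 cong_iff_dvd_diff)
  with assms(1) show False
    using coprime_common_divisor[of a b 2] by simp
qed

text \<open>For the Fibonacci numbers this is a form of Cassini's identity.\<close>

lemma gen_fib_invariant:
  "(gen_fib a b (Suc n))\<^sup>2 - gen_fib a b n * gen_fib a b (Suc n) - (gen_fib a b n)\<^sup>2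
     = (-1) ^ n * (b\<^sup>2 - a * b - a\<^sup>2)"
proof (induction n)
  case (Suc n)
  have "(gen_fib a b (Suc (Suc n)))\<^sup>2 - gen_fib a b (Suc n) * gen_fib a b (Suc (Suc n))
          - (gen_fib a b (Suc n))\<^sup>2
        = - ((gen_fib a b (Suc n))\<^sup>2 - gen_fib a b n * gen_fib a b (Suc n) - (gen_fib a b n)\<^sup>2)"
    by (simp add: power2_eq_square algebra_simps)
  then show ?case by (simp add: Suc)
qed simp

lemma odd_is_period_imp_dvd:
  assumes "is_period a b m k" "odd k"
  shows "m dvd 2 * (b\<^sup>2 - a * b - a\<^sup>2)"
proof -
  have "[(gen_fib a b (Suc k))\<^sup>2 - gen_fib a b k * gen_fib a b (Suc k) - (gen_fib a b k)\<^sup>2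
          = b\<^sup>2 - a * b - a\<^sup>2] (mod m)"
    using assms(1) unfolding is_period_def
    by (intro cong_diff cong_mult cong_pow) auto
  then have "m dvd - (b\<^sup>2 - a * b - a\<^sup>2) - (b\<^sup>2 - a * b - a\<^sup>2)"
    unfolding gen_fib_invariant cong_iff_dvd_diff using assms(2) by simp
  also have "- (b\<^sup>2 - a * b - a\<^sup>2) - (b\<^sup>2 - a * b - a\<^sup>2) = - (2 * (b\<^sup>2 - a * b - a\<^sup>2))"
    by simp
  finally show ?thesis by (simp only: dvd_minus_iff)
qed

lemma sum_gcd_eq_1_if_even_period:
  assumes "coprime a b" "odd k" "\<not> 3 dvd k" "\<And>m. m > 2 \<Longrightarrow> even (period a b m)"
  shows "sum_gcd a b k = 1"
proof (rule ccontr)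
  assume ne: "sum_gcd a b k \<noteq> 1"
  have "sum_gcd a b k \<ge> 0" by (simp add: sum_gcd_def)
  with ne consider "2 dvd sum_gcd a b k" | "sum_gcd a b k > 2"
    \<comment> \<open>The value 0 is even, so it falls under the first case together with 2.\<close>
    by (cases "sum_gcd a b k = 0 \<or> sum_gcd a b k = 2") auto
  then show False
  proof cases
    case 1
    then show False
      using assms(1,3) dvd_sum_gcd_imp_is_period is_period_2_imp_3_dvd by blast
  next
    case 2
    have "period a b (sum_gcd a b k) dvd k"
      by (intro period_dvd dvd_sum_gcd_imp_is_period) (use assms(2) odd_pos in auto)
    with assms(2,4) 2 show False
      using dvd_trans by blast
  qed
qed

lemma sum_gcd_dvd_invariant:
  assumes "coprime a b" "odd k" "\<not> 3 dvd k"
  shows "sum_gcd a b k dvd b\<^sup>2 - a * b - a\<^sup>2"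
proof -
  \<comment> \<open>Oddness allows the factor 2 in front of the invariant to be cancelled.\<close>
  have "odd (sum_gcd a b k)"
    using assms(1,3) dvd_sum_gcd_imp_is_period is_period_2_imp_3_dvd by blast
  moreover have "sum_gcd a b k dvd 2 * (b\<^sup>2 - a * b - a\<^sup>2)"
    using assms(2) by (intro odd_is_period_imp_dvd dvd_sum_gcd_imp_is_period) auto
  ultimately show ?thesis
    using coprime_dvd_mult_right_iff[of "sum_gcd a b k" 2] by (simp only: coprime_right_2_iff_odd not_False_eq_True True_implies_equals)
qed

text \<open>Modulo 5 the Lucas sequence runs 2, 1, 3, 4, 2, 1.\<close>

lemma period_lucas_5: "period 2 1 5 = 4"
  unfolding period_def
proof (rule Least_equality)
  fix r :: nat
  assume r: "r > 0 \<and> [gen_fib 2 1 r = 2] (mod 5) \<and> [gen_fib 2 1 (r + 1) = 1] (mod 5)"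
  show "4 \<le> r"
  proof (rule ccontr)
    assume "\<not> 4 \<le> r"
    with r have "r = 1 \<or> r = 2 \<or> r = 3" by auto
    with r show False
      by (auto simp: numeral_2_eq_2 numeral_3_eq_3 cong_def)
  qed
qed (simp add: eval_nat_numeral cong_def)

lemma lucas_sum_gcd_eq_1:
  assumes "odd k" "\<not> 3 dvd k"
  shows "lucas_sum_gcd k = 1"
proof -
  \<comment> \<open>The invariant of the pair (2, 1) is 1 - 2 - 4 = -5.\<close>
  have "lucas_sum_gcd k dvd 5"
    using sum_gcd_dvd_invariant[of 2 1 k] assms by (simp add: lucas_sum_gcd_def)
  moreover have "prime (5 :: int)" by simp
  moreover have "lucas_sum_gcd k \<ge> 0" by (simp add: lucas_sum_gcd_def sum_gcd_def)
  ultimately have "lucas_sum_gcd k = 1 \<or> lucas_sum_gcd k = 5"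
    using prime_int_iff by blast
  moreover have "lucas_sum_gcd k \<noteq> 5"
  proof
    assume "lucas_sum_gcd k = 5"
    then have "is_period 2 1 5 k"
      by (intro dvd_sum_gcd_imp_is_period) (simp add: lucas_sum_gcd_def)
    from period_dvd[OF this] have "4 dvd k"
      using assms(1) odd_pos by (simp add: period_lucas_5)
    with assms(1) show False by presburger
  qed
  ultimately show ?thesis by blast
qed

theorem theorem5p6:
  fixes k :: nat
  assumes "k > 0"
    and "[k = 1] (mod 12) \<or> [k = 5] (mod 12) \<or> [k = 7] (mod 12) \<or> [k = 11] (mod 12)"
  shows "(\<forall>G0 G1 :: int. coprime G0 G1 \<longrightarrow>
            (\<forall>m :: int. m > 2 \<longrightarrow> even (period G0 G1 m)) \<longrightarrow> sum_gcd G0 G1 k = 1)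
       \<and> fib_sum_gcd k = 1
       \<and> lucas_sum_gcd k = 1
       \<and> (\<forall>G0 G1 :: int. coprime G0 G1 \<longrightarrow>
            G1\<^sup>2 - G0 * G1 - G0\<^sup>2 = 1 \<or> G1\<^sup>2 - G0 * G1 - G0\<^sup>2 = -1 \<longrightarrow>
            sum_gcd G0 G1 k = 1)"
proof -
  have "k mod 12 \<in> {1, 5, 7, 11}"
    using assms(2) by (auto simp: cong_def)
  \<comment> \<open>The four residues are the units modulo 12, that is, those coprime to 2 and
    3.\<close>
  then have k: "odd k" "\<not> 3 dvd k"
    by (auto, presburger+)
  have unit: "sum_gcd G0 G1 k = 1"
    if "coprime G0 G1" "G1\<^sup>2 - G0 * G1 - G0\<^sup>2 = 1 \<or> G1\<^sup>2 - G0 * G1 - G0\<^sup>2 = -1" for G0 G1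
  proof -
    have "is_unit (sum_gcd G0 G1 k)"
      using sum_gcd_dvd_invariant[OF that(1) k] that(2) by auto
    moreover have "sum_gcd G0 G1 k \<ge> 0" by (simp add: sum_gcd_def)
    ultimately show ?thesis by simp
  qed
  \<comment> \<open>The pair (0, 1) has invariant 1.\<close>
  moreover have "fib_sum_gcd k = 1"
    unfolding fib_sum_gcd_def by (rule unit) simp_all
  ultimately show ?thesis
    using sum_gcd_eq_1_if_even_period[OF _ k] lucas_sum_gcd_eq_1[OF k] by (intro conjI allI impI) auto
qed

end
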